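(* Let $\mathcal{H}$ be a complex Hilbert space, $A\in\mathcal{B}(\mathcal{H})$ a positive operator, and $T,S\in\mathcal{B}_{A^{1/2}}(\mathcal{H})$. Then, for each choice of sign $\pm$, $$r_A(TS\pm ST)\leq\frac12\left(\omega_A(TS)+\omega_A(ST)+\sqrt{\left[\omega_A(TS)-\omega_A(ST)\right]^2+4\|T^2\|_A\|S^2\|_A}\right).$$ Moreover, if $TS=ST$, then $$r_A(TS)\leq\frac12\left(\omega_A(TS)+\|T^2\|_A^{1/2}\|S^2\|_A^{1/2}\right).$$
   Context: $\mathcal{B}(\mathcal{H})$ is the algebra of bounded linear operators on the complex Hilbert space $(\mathcal{H},\langle\cdot\mid\cdot\rangle)$. For positive $A$, put $\langle x\mid y\rangle_A=\langle Ax\mid y\rangle$ and $\|x\|_A=\langle x\mid x\rangle_A^{1/2}=\|A^{1/2}x\|$. $\mathcal{B}_{A^{1/2}}(\mathcal{H})$ is the set of $T\in\mathcal{B}(\mathcal{H})$ for which there is $\lambda>0$ with $\|Tx\|_A\le\lambda\|x\|_A$ for all $x\in\mathcal{H}$ ($A$-bounded operators). For such $T$, $\|T\|_A=\sup\{\|Tx\|_A: x\in\mathcal{H},\ \|x\|_A=1\}$, the $A$-numerical radius is $\omega_A(T)=\sup\{|\langle Tx\mid x\rangle_A|: x\in\mathcal{H},\ \|x\|_A=1\}$ (suprema over the empty set, occurring only if $A=0$, are $0$), and the $A$-spectral radius is $r_A(T)=\inf_{n\ge1}\|T^n\|_A^{1/n}=\lim_{n\to\infty}\|T^n\|_A^{1/n}$.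 *)

theory Defs
  imports "HOL-Analysis.Analysis"
begin

class complex_vector = real_vector +
  fixes scaleC :: "complex \<Rightarrow> 'a \<Rightarrow> 'a" (infixr "*\<^sub>C" 75)
  assumes scaleC_add_right: "c *\<^sub>C (x + y) = c *\<^sub>C x + c *\<^sub>C y"
    and scaleC_add_left: "(c + d) *\<^sub>C x = c *\<^sub>C x + d *\<^sub>C x"
    and scaleC_scaleC: "c *\<^sub>C (d *\<^sub>C x) = (c * d) *\<^sub>C x"
    and scaleC_one: "1 *\<^sub>C x = x"
    and scaleR_scaleC: "r *\<^sub>R x = complex_of_real r *\<^sub>C x"

text \<open>
  The complex inner product is linear in the first argument. Definiteness and
  the formula for the norm are inherited from \<^class>\<open>real_inner\<close>, since
  hermitian symmetry makes \<open>cinner x x\<close> real, hence equal to \<open>inner x x\<close>.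
\<close>

class complex_inner = complex_vector + real_inner +
  fixes cinner :: "'a \<Rightarrow> 'a \<Rightarrow> complex"
  assumes cinner_commute: "cinner x y = cnj (cinner y x)"
    and cinner_add_left: "cinner (x + y) z = cinner x z + cinner y z"
    and cinner_scaleC_left: "cinner (c *\<^sub>C x) y = c * cinner x y"
    and inner_eq_Re_cinner: "inner x y = Re (cinner x y)"

class chilbert_space = complex_inner + complete_space

instantiation complex :: chilbert_space
begin

definition scaleC_complex :: "complex \<Rightarrow> complex \<Rightarrow> complex"
  where "scaleC_complex c x = c * x"

definition cinner_complex :: "complex \<Rightarrow> complex \<Rightarrow> complex"
  where "cinner_complex x y = x * cnj y"

instance
  by standard
    (auto simp: scaleC_complex_def cinner_complex_def inner_complex_def
      scaleR_conv_of_real algebra_simps)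

end

definition bounded_clinear :: "('a::chilbert_space \<Rightarrow> 'a) \<Rightarrow> bool"
  where "bounded_clinear T \<longleftrightarrow> bounded_linear T \<and> (\<forall>c x. T (c *\<^sub>C x) = c *\<^sub>C T x)"

definition positive_op :: "('a::chilbert_space \<Rightarrow> 'a) \<Rightarrow> bool"
  where "positive_op A \<longleftrightarrow>
    bounded_clinear A \<and> (\<forall>x. cinner (A x) x \<in> \<real> \<and> 0 \<le> Re (cinner (A x) x))"

definition A_inner :: "('a::chilbert_space \<Rightarrow> 'a) \<Rightarrow> 'a \<Rightarrow> 'a \<Rightarrow> complex"
  where "A_inner A x y = cinner (A x) y"

definition A_norm :: "('a::chilbert_space \<Rightarrow> 'a) \<Rightarrow> 'a \<Rightarrow> real"
  where "A_norm A x = sqrt (Re (A_inner A x x))"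

definition A_bounded :: "('a::chilbert_space \<Rightarrow> 'a) \<Rightarrow> ('a \<Rightarrow> 'a) \<Rightarrow> bool"
  where "A_bounded A T \<longleftrightarrow>
    bounded_clinear T \<and> (\<exists>b>0. \<forall>x. A_norm A (T x) \<le> b * A_norm A x)"

text \<open>
  \<open>Sup {}\<close> is unspecified on \<^typ>\<open>real\<close>; the convention here is that it is \<open>0\<close>.
  For positive \<open>A\<close> the set of \<open>A\<close>-unit vectors is empty exactly when \<open>A = 0\<close>.
\<close>

definition Sup0 :: "real set \<Rightarrow> real"
  where "Sup0 X = (if X = {} then 0 else Sup X)"

definition A_op_norm :: "('a::chilbert_space \<Rightarrow> 'a) \<Rightarrow> ('a \<Rightarrow> 'a) \<Rightarrow> real"
  where "A_op_norm A T = Sup0 {A_norm A (T x) | x. A_norm A x = 1}"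

definition A_num_radius :: "('a::chilbert_space \<Rightarrow> 'a) \<Rightarrow> ('a \<Rightarrow> 'a) \<Rightarrow> real"
  where "A_num_radius A T = Sup0 {cmod (A_inner A (T x) x) | x. A_norm A x = 1}"

definition A_spec_radius :: "('a::chilbert_space \<Rightarrow> 'a) \<Rightarrow> ('a \<Rightarrow> 'a) \<Rightarrow> real"
  where "A_spec_radius A T = (INF n\<in>{1..}. root n (A_op_norm A (T ^^ n)))"

end

theory Submission
  imports Defs
begin

text \<open>
  Everything takes place for a positive semidefinite sesquilinear form, without completeness.
  A sum \<open>P = T1 S1 + T2 S2\<close> factors as \<open>U V\<close> through the space of pairs, where \<open>V U\<close> is the
  operator matrix \<open>M\<close> with rows \<open>(S1 T1, S1 T2)\<close> and \<open>(S2 T1, S2 T2)\<close>; hence the spectral radius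
  of \<open>P\<close> is at most that of \<open>M\<close>. The latter is at most the numerical radius of \<open>M\<close>, because
  \<open>\<omega>(M\<^sup>2) \<le> \<omega>(M)\<^sup>2\<close> and \<open>\<parallel>M\<parallel> \<le> 2 \<omega>(M)\<close>, so that \<open>M\<^sup>n\<close> grows no faster than \<open>2 \<omega>(M)\<^sup>n\<close> along
  the powers \<open>n\<close> of two. Finally \<open>\<omega>(M)\<close> is compared with the largest eigenvalue of the real 2x2
  matrix with diagonal \<open>\<omega>(S1 T1), \<omega>(S2 T2)\<close> and off-diagonal entries
  \<open>\<parallel>S1 T2\<parallel>, \<parallel>S2 T1\<parallel>\<close>. Giving the second component of pairs a weight \<open>t\<close> balances the
  off-diagonal entries, so that only their product matters. The theorem uses
  \<open>(T1, S1, T2, S2) = (T, S, S, \<plusminus>T)\<close>, and \<open>(T/2, S, S/2, T)\<close> in the commuting case.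
\<close>

section \<open>Complex-linear maps and pairs of vectors\<close>

definition complex_linear :: "('a::complex_vector \<Rightarrow> 'b::complex_vector) \<Rightarrow> bool"
  where "complex_linear f \<longleftrightarrow>
    (\<forall>x y. f (x + y) = f x + f y) \<and> (\<forall>c x. f (c *\<^sub>C x) = c *\<^sub>C f x)"

lemma complex_linear_add: "complex_linear f \<Longrightarrow> f (x + y) = f x + f y"
  and complex_linear_scaleC: "complex_linear f \<Longrightarrow> f (c *\<^sub>C x) = c *\<^sub>C f x"
  by (auto simp: complex_linear_def)

lemma scaleC_minus1: "(-1) *\<^sub>C x = - (x::'a::complex_vector)"
  using scaleR_scaleC[of "-1" x] by simp

lemma complex_linear_minus: "complex_linear f \<Longrightarrow> f (- x) = - f x"
  using complex_linear_scaleC[of f "-1" x] by (simp add: scaleC_minus1)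

lemma complex_linear_diff: "complex_linear f \<Longrightarrow> f (x - y) = f x - f y"
  using complex_linear_add[of f x "- y"] by (simp add: complex_linear_minus)

lemma complex_linear_compose:
  assumes "complex_linear f" "complex_linear g"
  shows "complex_linear (\<lambda>x. f (g x))"
  using complex_linear_add[OF assms(1)] complex_linear_add[OF assms(2)]
    complex_linear_scaleC[OF assms(1)] complex_linear_scaleC[OF assms(2)]
  unfolding complex_linear_def by metis

lemma complex_linear_scaleC_compose:
  assumes "complex_linear f"
  shows "complex_linear (\<lambda>x. c *\<^sub>C f x)"
  using complex_linear_add[OF assms] complex_linear_scaleC[OF assms]
  by (simp add: complex_linear_def scaleC_add_right scaleC_scaleC mult.commute)

lemma complex_linear_funpow:
  fixes f :: "'a::complex_vector \<Rightarrow> 'a"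
  assumes "complex_linear f"
  shows "complex_linear (f ^^ n)"
proof (induction n)
  case 0
  then show ?case by (simp add: complex_linear_def)
next
  case (Suc n)
  then show ?case using complex_linear_compose[OF assms Suc] by (simp add: comp_def)
qed

instantiation prod :: (complex_vector, complex_vector) complex_vector
begin

definition scaleC_prod :: "complex \<Rightarrow> 'a \<times> 'b \<Rightarrow> 'a \<times> 'b"
  where "scaleC_prod c p = (c *\<^sub>C fst p, c *\<^sub>C snd p)"

instance
  by standard
    (auto simp: scaleC_prod_def scaleC_add_right scaleC_add_left scaleC_scaleC scaleC_one
      scaleR_prod_def scaleR_scaleC)

end

section \<open>Semidefinite sesquilinear forms and numerical radius estimates\<close>

locale semi_inner =
  fixes B :: "'v::complex_vector \<Rightarrow> 'v \<Rightarrow> complex"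
  assumes add_left: "B (x + y) z = B x z + B y z"
    and add_right: "B x (y + z) = B x y + B x z"
    and scaleC_left: "B (c *\<^sub>C x) y = c * B x y"
    and scaleC_right: "B x (c *\<^sub>C y) = cnj c * B x y"
    and diag_real: "B x x \<in> \<real>"
    and diag_nonneg: "0 \<le> Re (B x x)"
begin

definition q :: "'v \<Rightarrow> real" where "q x = Re (B x x)"

lemma B_diag: "B x x = of_real (q x)"
  using diag_real[of x] by (simp add: q_def)

lemma q_nonneg: "0 \<le> q x"
  using diag_nonneg by (simp add: q_def)

lemma minus_left: "B (- x) y = - B x y" and minus_right: "B x (- y) = - B x y"
  using scaleC_left[of "-1" x y] scaleC_right[of x "-1" y] by (simp_all add: scaleC_minus1)

lemma diff_left: "B (x - y) z = B x z - B y z" and diff_right: "B x (y - z) = B x y - B x z"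
  using add_left[of x "-y" z] add_right[of x y "-z"] by (simp_all add: minus_left minus_right)

lemmas B_simps = add_left add_right diff_left diff_right minus_left minus_right
  scaleC_left scaleC_right

text \<open>Symmetry comes from reality of the diagonal: at \<open>x + y\<close> it makes the
  imaginary parts of \<open>B x y\<close> and \<open>B y x\<close> opposite, at
  \<open>\<i> *\<^sub>C x + y\<close> it makes their real parts equal.\<close>

lemma B_commute: "B x y = cnj (B y x)"
proof -
  have "Im (B (x + y) (x + y)) = 0" "Im (B (\<i> *\<^sub>C x + y) (\<i> *\<^sub>C x + y)) = 0"
    by (simp_all only: B_diag Im_complex_of_real)
  moreover have "Im (B x x) = 0" "Im (B y y) = 0"
    by (simp_all only: B_diag Im_complex_of_real)
  ultimately show ?thesis
    by (simp add: B_simps complex_eq_iff)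
qed

lemma q_scaleC: "q (c *\<^sub>C x) = (cmod c)\<^sup>2 * q x"
proof -
  have "B (c *\<^sub>C x) (c *\<^sub>C x) = of_real ((cmod c)\<^sup>2 * q x)"
    using complex_norm_square[of c] by (simp add: B_simps B_diag[of x])
  then show ?thesis by (simp add: q_def)
qed

lemma q_parallelogram: "q (x + y) + q (x - y) = 2 * q x + 2 * q y"
  by (simp add: q_def B_simps)

lemma cauchy_schwarz: "(cmod (B x y))\<^sup>2 \<le> q x * q y"
proof -
  have *: "(cmod (B x y))\<^sup>2 \<le> q x * q y" if "0 < q y" for x y
  proof -
    \<comment> \<open>\<open>?z\<close> is \<open>q y\<close> times the component of
      \<open>x\<close> orthogonal to \<open>y\<close>; the scaling avoids a division.\<close>
    let ?z = "of_real (q y) *\<^sub>C x - B x y *\<^sub>C y"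
    have cc: "B x y * B y x = of_real ((cmod (B x y))\<^sup>2)"
      using B_commute[of y x] complex_norm_square[of "B x y"] by simp
    have "B ?z ?z = of_real (q y) * (of_real (q x) * of_real (q y) - B x y * B y x)"
      by (simp add: B_simps B_diag[of x] B_diag[of y] B_commute[of y x] algebra_simps)
    also have "\<dots> = of_real (q y * (q x * q y - (cmod (B x y))\<^sup>2))"
      unfolding cc by simp
    finally have "q ?z = q y * (q x * q y - (cmod (B x y))\<^sup>2)"
      by (simp add: q_def)
    then show ?thesis
      using q_nonneg[of ?z] that by (simp add: zero_le_mult_iff)
  qed
  consider "0 < q y" | "0 < q x" | "q x = 0" "q y = 0"
    using q_nonneg[of x] q_nonneg[of y] by linarith
  then show ?thesis
  proof cases
    case 2
    then show ?thesis
      using *[of x y] B_commute[of x y] by (simp add: mult.commute)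
  next
    case 3
    \<comment> \<open>When \<open>x\<close> and \<open>y\<close> are both null, \<open>q ?z\<close>
      is \<open>-2 |B x y|^2\<close>, so nonnegativity forces \<open>B x y = 0\<close>.\<close>
    let ?z = "x - B x y *\<^sub>C y"
    have "Re (B ?z ?z) = - 2 * (cmod (B x y))\<^sup>2"
      using 3 cmod_power2[of "B x y"]
      by (simp add: B_simps B_diag[of x] B_diag[of y] B_commute[of y x] power2_eq_square)
    then show ?thesis
      using q_nonneg[of ?z] 3 by (simp add: q_def)
  qed (rule *)
qed

text \<open>With \<open>y = w x + c T x\<close> and \<open>z = w x - c T x\<close> one has
  \<open>w y - c T y = w z + c T z = w\<^sup>2 x - c\<^sup>2 T\<^sup>2 x\<close> and \<open>y + z = 2 w x\<close>, so
  adding the hypotheses at \<open>y\<close> and \<open>z\<close> bounds \<open>Re (c\<^sup>2 B (T\<^sup>2 x) x)\<close>.\<close>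

lemma num_radius_square:
  assumes T: "complex_linear T" and w: "0 < w"
    and le: "\<And>x. cmod (B (T x) x) \<le> w * q x"
  shows "cmod (B (T (T x)) x) \<le> w\<^sup>2 * q x"
proof -
  have "Re (c\<^sup>2 * B (T (T x)) x) \<le> w\<^sup>2 * q x" if c: "cmod c = 1" for c
  proof -
    let ?w = "complex_of_real w"
    define y where "y = ?w *\<^sub>C x + c *\<^sub>C T x"
    define z where "z = ?w *\<^sub>C x - c *\<^sub>C T x"
    note lin = complex_linear_add[OF T] complex_linear_diff[OF T] complex_linear_scaleC[OF T]
    have "Re (c * B (T y) y) \<le> w * q y"
      using le[of y] complex_Re_le_cmod[of "c * B (T y) y"] c by (simp add: norm_mult)
    moreover have "- Re (c * B (T z) z) \<le> w * q z"
      using le[of z] abs_Re_le_cmod[of "c * B (T z) z"] c by (simp add: norm_mult)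
    moreover have "?w * B y y - c * B (T y) y + ?w * B z z + c * B (T z) z
        = of_real (2 * w) * (of_real (w\<^sup>2 * q x) - c\<^sup>2 * B (T (T x)) x)"
      unfolding y_def z_def
      by (simp add: lin B_simps B_diag[of x] algebra_simps power2_eq_square)
    then have "w * q y - Re (c * B (T y) y) + w * q z + Re (c * B (T z) z)
        = 2 * w * (w\<^sup>2 * q x - Re (c\<^sup>2 * B (T (T x)) x))"
      unfolding B_diag by (simp add: complex_eq_iff)
    ultimately have "0 \<le> 2 * w * (w\<^sup>2 * q x - Re (c\<^sup>2 * B (T (T x)) x))"
      by linarith
    then show ?thesis using w by (simp add: zero_le_mult_iff)
  qed
  note * = this
  show ?thesis
  proof (cases "B (T (T x)) x = 0")
    case False
    let ?b = "B (T (T x)) x"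
    \<comment> \<open>The bound involves \<open>c\<^sup>2\<close>, and it is this square that has to
      rotate \<open>?b\<close> onto the positive real axis.\<close>
    define c where "c = csqrt (cnj (sgn ?b))"
    have "cmod c = 1" using False by (simp add: c_def norm_csqrt norm_sgn)
    moreover have "cnj (sgn ?b) * ?b = of_real (cmod ?b)"
      using False complex_norm_square[of ?b]
      by (simp add: sgn_eq field_simps power2_eq_square)
    then have "c\<^sup>2 * ?b = of_real (cmod ?b)"
      by (simp add: c_def)
    ultimately show ?thesis using *[of c] by simp
  qed (use q_nonneg in simp)
qed

text \<open>The power inequality for the numerical radius along dyadic exponents: each step applies
  the squaring estimate to \<open>T ^^ (2 ^ k)\<close> and \<open>w ^ (2 ^ k)\<close>.\<close>

lemma num_radius_power2:
  assumes T: "complex_linear T" and w: "0 < w"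
    and le: "\<And>x. cmod (B (T x) x) \<le> w * q x"
  shows "cmod (B ((T ^^ (2 ^ k)) x) x) \<le> w ^ (2 ^ k) * q x"
proof (induction k arbitrary: x)
  case 0
  then show ?case using le by simp
next
  case (Suc k)
  have "T ^^ (2 ^ Suc k) = (T ^^ (2 ^ k)) \<circ> (T ^^ (2 ^ k))"
    by (simp flip: funpow_add add: mult_2)
  moreover have "w ^ (2 ^ Suc k) = (w ^ (2 ^ k))\<^sup>2"
    by (simp only: power_Suc power_even_eq)
  ultimately show ?case
    using num_radius_square[OF complex_linear_funpow[OF T] zero_less_power[OF w] Suc.IH]
    by (simp only: comp_apply)
qed

text \<open>The classical \<open>\<parallel>T\<parallel> \<le> 2 \<omega>(T)\<close>, squared:
  polarization carries the bound from \<open>B (T x) x\<close> to \<open>B (T x) y\<close>, and then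
  \<open>y\<close> is taken to be a multiple of \<open>T x\<close>.\<close>

lemma norm_le_num_radius:
  assumes T: "complex_linear T" and w: "0 < w"
    and le: "\<And>x. cmod (B (T x) x) \<le> w * q x"
  shows "q (T x) \<le> 4 * w\<^sup>2 * q x"
proof -
  have pol: "cmod (B (T x) y) \<le> w * (q x + q y)" for y
  proof -
    note lin = complex_linear_add[OF T] complex_linear_diff[OF T] complex_linear_scaleC[OF T]
    let ?f = "\<lambda>x. B (T x) x"
    let ?u = "\<i> *\<^sub>C y"
    have "4 * B (T x) y = (?f (x + y) - ?f (x - y)) + \<i> * (?f (x + ?u) - ?f (x - ?u))"
      by (simp add: lin B_simps algebra_simps)
    also have "cmod \<dots> \<le> cmod (?f (x + y) - ?f (x - y)) + cmod (?f (x + ?u) - ?f (x - ?u))"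
      by (rule order_trans[OF norm_triangle_ineq]) (simp add: norm_mult)
    also have "\<dots> \<le> (cmod (?f (x + y)) + cmod (?f (x - y)))
        + (cmod (?f (x + ?u)) + cmod (?f (x - ?u)))"
      by (intro add_mono norm_triangle_ineq4)
    also have "\<dots> \<le> (w * q (x + y) + w * q (x - y)) + (w * q (x + ?u) + w * q (x - ?u))"
      by (intro add_mono le)
    also have "\<dots> = w * ((q (x + y) + q (x - y)) + (q (x + ?u) + q (x - ?u)))"
      by (simp add: algebra_simps)
    also have "\<dots> = 4 * (w * (q x + q y))"
      unfolding q_parallelogram q_scaleC by simp
    finally show ?thesis by (simp add: norm_mult)
  qed
  \<comment> \<open>This value makes \<open>w * s\<^sup>2 * q (T x)\<close> half of
    \<open>s * q (T x)\<close>, so that it is absorbed on the left.\<close>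
  define s where "s = 1 / (2 * w)"
  have s: "0 < s" using w by (simp add: s_def)
  have "s * q (T x) \<le> w * (q x + s\<^sup>2 * q (T x))"
    using pol[of "of_real s *\<^sub>C T x"] s q_nonneg[of "T x"]
    by (simp add: B_simps B_diag q_scaleC norm_mult)
  then show ?thesis
    using w by (simp add: s_def field_simps power2_eq_square)
qed

end

section \<open>Weighted pairs and 2x2 operator matrices\<close>

definition pair_form :: "real \<Rightarrow> ('v \<Rightarrow> 'v \<Rightarrow> complex) \<Rightarrow> 'v \<times> 'v \<Rightarrow> 'v \<times> 'v \<Rightarrow> complex"
  where "pair_form t B p r = B (fst p) (fst r) + of_real t * B (snd p) (snd r)"

context semi_inner
begin

lemma semi_inner_pair_form:
  assumes "0 < t"
  shows "semi_inner (pair_form t B)"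
  by standard
    (use assms in \<open>auto simp: pair_form_def B_simps scaleC_prod_def B_diag q_nonneg algebra_simps\<close>)

lemma q_pair_form:
  assumes "0 < t"
  shows "semi_inner.q (pair_form t B) p = q (fst p) + t * q (snd p)"
  using assms by (simp add: semi_inner.q_def[OF semi_inner_pair_form] pair_form_def B_diag)

text \<open>With \<open>X = sqrt (q x)\<close> and \<open>Y = sqrt (q y)\<close>, the triangle and
  Cauchy-Schwarz inequalities reduce the claim to
  \<open>(w - a) X^2 - (b + t c) X Y + t (w - d) Y^2 \<ge> 0\<close>; \<open>det\<close> is the
  discriminant condition of this real quadratic form.\<close>

lemma num_radius_matrix:
  assumes t: "0 < t" and b: "0 \<le> b" and c: "0 \<le> c" and aw: "a < w" and dw: "d < w"
    and det: "(b + t * c)\<^sup>2 \<le> 4 * t * ((w - a) * (w - d))"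
    and a_le: "\<And>x. cmod (B (F x) x) \<le> a * q x"
    and d_le: "\<And>x. cmod (B (N x) x) \<le> d * q x"
    and b_le: "\<And>x. q (G x) \<le> b\<^sup>2 * q x"
    and c_le: "\<And>x. q (H x) \<le> c\<^sup>2 * q x"
  shows "cmod (pair_form t B (F x + G y, H x + N y) (x, y)) \<le> w * (q x + t * q y)"
proof -
  let ?x = "sqrt (q x)" and ?y = "sqrt (q y)"
  have cs: "cmod (B u v) \<le> sqrt (q u) * sqrt (q v)" for u v
    using cauchy_schwarz[of u v] by (metis real_le_rsqrt real_sqrt_mult)
  have "sqrt (q (G y)) \<le> b * ?y"
    using real_sqrt_le_mono[OF b_le[of y]] b by (simp add: real_sqrt_mult)
  then have G: "cmod (B (G y) x) \<le> b * ?y * ?x"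
    by (rule order_trans[OF cs mult_right_mono]) (simp add: q_nonneg)
  have "sqrt (q (H x)) \<le> c * ?x"
    using real_sqrt_le_mono[OF c_le[of x]] c by (simp add: real_sqrt_mult)
  then have H: "cmod (B (H x) y) \<le> c * ?x * ?y"
    by (rule order_trans[OF cs mult_right_mono]) (simp add: q_nonneg)
  have cross: "(b + t * c) * (?x * ?y) \<le> (w - a) * q x + t * (w - d) * q y"
  proof -
    have "((b + t * c) * (?x * ?y))\<^sup>2 = (b + t * c)\<^sup>2 * (q x * q y)"
      by (simp add: power_mult_distrib q_nonneg)
    also have "\<dots> \<le> 4 * t * ((w - a) * (w - d)) * (q x * q y)"
      by (intro mult_right_mono det) (simp add: q_nonneg)
    also have "\<dots> = 4 * ((w - a) * q x) * (t * (w - d) * q y)"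
      by simp
    also have "\<dots> \<le> ((w - a) * q x + t * (w - d) * q y)\<^sup>2"
      using zero_le_power2[of "(w - a) * q x - t * (w - d) * q y"]
      by (simp only: power2_sum power2_diff)
    finally have "((b + t * c) * (?x * ?y))\<^sup>2 \<le> ((w - a) * q x + t * (w - d) * q y)\<^sup>2" .
    moreover have "0 \<le> (w - a) * q x + t * (w - d) * q y"
      using t aw dw q_nonneg by (intro add_nonneg_nonneg mult_nonneg_nonneg) auto
    ultimately show ?thesis by (rule power2_le_imp_le)
  qed
  have "cmod (pair_form t B (F x + G y, H x + N y) (x, y))
      \<le> (cmod (B (F x) x) + cmod (B (G y) x)) + t * (cmod (B (H x) y) + cmod (B (N y) y))"
    unfolding pair_form_def fst_conv snd_conv add_left
    by (rule order_trans[OF norm_triangle_ineq add_mono[OF norm_triangle_ineq]])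
      (use t norm_triangle_ineq in \<open>simp add: norm_mult\<close>)
  also have "\<dots> \<le> (a * q x + b * ?y * ?x) + t * (c * ?x * ?y + d * q y)"
    using t by (intro add_mono mult_left_mono a_le d_le G H) simp_all
  also have "\<dots> \<le> w * (q x + t * q y)"
    using cross by (simp add: algebra_simps)
  finally show ?thesis .
qed

end

text \<open>The infimum of \<open>(b + t c)^2 / t\<close> over positive \<open>t\<close> is
  \<open>4 b c\<close>, attained at \<open>t = b / c\<close> if both are positive. If exactly one of
  them vanishes it is only approached, hence the strict inequality.\<close>

lemma exists_balancing_weight:
  fixes b c K :: real
  assumes "0 \<le> b" "0 \<le> c" "b * c < K"
  shows "\<exists>t>0. (b + t * c)\<^sup>2 \<le> 4 * t * K"
proof -
  consider "0 < b" "0 < c" | "b = 0" | "c = 0" using assms by linarith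
  then show ?thesis
  proof cases
    case 1
    show ?thesis
    proof (intro exI conjI)
      show "0 < b / c" using 1 by simp
      have "(b + b / c * c)\<^sup>2 = 4 * (b / c) * (b * c)"
        using 1 by (simp add: power2_eq_square)
      also have "\<dots> \<le> 4 * (b / c) * K"
        using 1 assms by (intro mult_left_mono) simp_all
      finally show "(b + b / c * c)\<^sup>2 \<le> 4 * (b / c) * K" .
    qed
  next
    case 2
    \<comment> \<open>For \<open>b = 0\<close> it suffices that \<open>t c^2 \<le> 4 K\<close>; the
      added 1 covers \<open>c = 0\<close>.\<close>
    define t where "t = K / (c\<^sup>2 + 1)"
    have K: "0 < K" using 2 assms by simp
    have t: "0 < t" "t * c\<^sup>2 \<le> K"
      using K by (simp_all add: t_def divide_simps add_nonneg_pos mult_left_mono)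
    have "(b + t * c)\<^sup>2 = t * (t * c\<^sup>2)"
      using 2 by (simp add: power2_eq_square)
    also have "\<dots> \<le> t * (4 * K)"
      using t K by (intro mult_left_mono) simp_all
    finally show ?thesis using t by (auto simp: mult_ac)
  next
    case 3
    then have "0 < K" using assms by simp
    \<comment> \<open>For \<open>c = 0\<close> any weight with \<open>b^2 \<le> 4 t K\<close> works;
      the added 1 keeps it positive when \<open>b = 0\<close>.\<close>
    then have "0 < b\<^sup>2 / K + 1" by (intro add_nonneg_pos) simp_all
    moreover have "(b + (b\<^sup>2 / K + 1) * c)\<^sup>2 \<le> 4 * (b\<^sup>2 / K + 1) * K"
      using 3 \<open>0 < K\<close> by (simp add: algebra_simps)
    ultimately show ?thesis by blast
  qed
qed

context semi_inner
begin

text \<open>\<open>P = U V\<close> with \<open>U (x, y) = T1 x + T2 y\<close> and \<open>V x = (S1 x, S2 x)\<close>, and the operator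
  matrix is \<open>M = V U\<close>, so \<open>P\<^sup>n\<^sup>+\<^sup>1 = U M\<^sup>n V\<close>.\<close>

lemma powers_sum_le:
  assumes lin: "complex_linear T1" "complex_linear T2" "complex_linear S1" "complex_linear S2"
    and bd: "\<And>x. q (T1 x) \<le> k * q x" "\<And>x. q (T2 x) \<le> k * q x"
      "\<And>x. q (S1 x) \<le> k * q x" "\<And>x. q (S2 x) \<le> k * q x" and k: "0 \<le> k"
    and b: "0 \<le> b" and c: "0 \<le> c" and w: "0 < w" "a < w" "d < w"
    and det: "b * c < (w - a) * (w - d)"
    and a_le: "\<And>x. cmod (B (S1 (T1 x)) x) \<le> a * q x"
    and d_le: "\<And>x. cmod (B (S2 (T2 x)) x) \<le> d * q x"
    and b_le: "\<And>x. q (S1 (T2 x)) \<le> b\<^sup>2 * q x"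
    and c_le: "\<And>x. q (S2 (T1 x)) \<le> c\<^sup>2 * q x"
  shows "\<exists>C\<ge>0. \<forall>m x. q (((\<lambda>x. T1 (S1 x) + T2 (S2 x)) ^^ Suc (2 ^ m)) x)
    \<le> C * (w ^ (2 ^ m))\<^sup>2 * q x"
proof -
  obtain t where t: "0 < t" "(b + t * c)\<^sup>2 \<le> 4 * t * ((w - a) * (w - d))"
    using exists_balancing_weight[OF b c det] by auto
  interpret M: semi_inner "pair_form t B" by (rule semi_inner_pair_form[OF t(1)])
  define U where "U = (\<lambda>p. T1 (fst p) + T2 (snd p))"
  define V where "V = (\<lambda>x. (S1 x, S2 x))"
  define M where "M = (\<lambda>p. V (U p))"
  define P where "P = (\<lambda>x. T1 (S1 x) + T2 (S2 x))"
  have linM: "complex_linear M"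
    using lin by (simp add: complex_linear_def M_def U_def V_def scaleC_prod_def scaleC_add_right)
  have num: "cmod (pair_form t B (M p) p) \<le> w * M.q p" for p
    using num_radius_matrix[OF t(1) b c w(2,3) t(2), of "\<lambda>x. S1 (T1 x)" "\<lambda>x. S2 (T2 x)"
        "\<lambda>x. S1 (T2 x)" "\<lambda>x. S2 (T1 x)" "fst p" "snd p"] a_le d_le b_le c_le
    by (simp add: M_def U_def V_def q_pair_form[OF t(1)] complex_linear_add[OF lin(3)]
        complex_linear_add[OF lin(4)])
  \<comment> \<open>The factor 4 is the square of the 2 in
    \<open>\<parallel>M\<parallel> \<le> 2 \<omega>(M)\<close>. That estimate is applied once, to
    the whole power, so the factor does not grow with \<open>m\<close>.\<close>
  have qM: "M.q ((M ^^ (2 ^ m)) p) \<le> 4 * (w ^ (2 ^ m))\<^sup>2 * M.q p" for m p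
    by (rule M.norm_le_num_radius[OF complex_linear_funpow[OF linM] _
          M.num_radius_power2[OF linM w(1) num]]) (use w in simp)
  have qU: "q (U p) \<le> 2 * k * (1 + 1 / t) * M.q p" for p
  proof -
    let ?x = "fst p" and ?y = "snd p"
    have "q (U p) \<le> 2 * q (T1 ?x) + 2 * q (T2 ?y)"
      using q_parallelogram[of "T1 ?x" "T2 ?y"] q_nonneg[of "T1 ?x - T2 ?y"] by (simp add: U_def)
    also have "\<dots> \<le> 2 * k * (q ?x + q ?y)"
      using bd(1)[of ?x] bd(2)[of ?y] by (simp add: algebra_simps)
    \<comment> \<open>The factor \<open>1 + 1 / t\<close> compares the unweighted sum with the
      weighted one, whether \<open>t\<close> is small or large.\<close>
    also have "\<dots> \<le> 2 * k * ((1 + 1 / t) * (q ?x + t * q ?y))"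
      using k t(1) q_nonneg[of ?x] q_nonneg[of ?y]
      by (intro mult_left_mono) (simp_all add: algebra_simps)
    finally show ?thesis by (simp add: q_pair_form[OF t(1)] mult.assoc)
  qed
  have qV: "M.q (V x) \<le> k * (1 + t) * q x" for x
    using add_mono[OF bd(3)[of x] mult_left_mono[OF bd(4)[of x] less_imp_le[OF t(1)]]]
    by (simp add: q_pair_form[OF t(1)] V_def algebra_simps)
  have pow: "(P ^^ Suc n) x = U ((M ^^ n) (V x))" for n x
  proof (induction n)
    case (Suc n)
    have "(P ^^ Suc (Suc n)) x = P (U ((M ^^ n) (V x)))"
      using Suc by simp
    also have "\<dots> = U (V (U ((M ^^ n) (V x))))"
      by (simp add: P_def U_def V_def)
    finally show ?case by (simp add: M_def)
  qed (simp add: P_def U_def V_def)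
  let ?C = "2 * k * (1 + 1 / t) * (4 * (k * (1 + t)))"
  have "q ((P ^^ Suc (2 ^ m)) x) \<le> ?C * (w ^ (2 ^ m))\<^sup>2 * q x" for m x
  proof -
    have "q ((P ^^ Suc (2 ^ m)) x) \<le> 2 * k * (1 + 1 / t) * M.q ((M ^^ (2 ^ m)) (V x))"
      unfolding pow by (rule qU)
    also have "\<dots> \<le> 2 * k * (1 + 1 / t) * (4 * (w ^ (2 ^ m))\<^sup>2 * (k * (1 + t) * q x))"
      using k t(1)
      by (intro mult_left_mono order_trans[OF qM] mult_left_mono[OF qV]) simp_all
    finally show ?thesis by (simp only: mult_ac)
  qed
  moreover have "0 \<le> ?C" using k t(1) by simp
  ultimately show ?thesis unfolding P_def by blast
qed

end

section \<open>The form of a positive operator, and the suprema and infima of the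
  definitions\<close>

lemma semi_inner_A_inner:
  assumes "positive_op A"
  shows "semi_inner (A_inner A)"
proof -
  have lin: "A (x + y) = A x + A y" "A (c *\<^sub>C x) = c *\<^sub>C A x" for x y c
    using assms by (auto simp: positive_op_def bounded_clinear_def linear_simps)
  have right: "cinner x (y + z) = cinner x y + cinner x z"
      "cinner x (c *\<^sub>C y) = cnj c * cinner x y" for x y z :: 'a and c
    using cinner_commute[of x] cinner_commute[of _ x]
    by (metis cinner_add_left complex_cnj_add, metis cinner_scaleC_left complex_cnj_mult)
  show ?thesis
    using assms
    by unfold_locales
      (simp_all add: A_inner_def lin right cinner_add_left cinner_scaleC_left positive_op_def)
qed

lemma A_bounded_complex_linear: "A_bounded A T \<Longrightarrow> complex_linear T"
  by (auto simp: A_bounded_def bounded_clinear_def complex_linear_def linear_simps)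

text \<open>If the infimum \<open>r\<close> exceeded \<open>w\<close>, then
  \<open>r ^ n \<le> f n\<close> would keep the powers \<open>(r / w) ^ (2 ^ m)\<close> bounded,
  although \<open>r / w > 1\<close>. The exponents \<open>Suc (2 ^ m)\<close> are those produced by
  \<open>P\<^sup>n\<^sup>+\<^sup>1 = U M\<^sup>n V\<close>.\<close>

lemma INF_root_le_of_dyadic_growth:
  assumes "\<And>n::nat. 0 \<le> f n" and "0 \<le> K" and "0 < w"
    and le: "\<And>m. f (Suc (2 ^ m)) \<le> K * w ^ (2 ^ m)"
  shows "(INF n\<in>{1..}. root n (f n)) \<le> w"
proof (rule ccontr)
  let ?r = "INF n\<in>{1..}. root n (f n)"
  assume "\<not> ?r \<le> w"
  then have r: "w < ?r" by simp
  have "bdd_below ((\<lambda>n. root n (f n)) ` {1..})"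
    using assms(1) by (intro bdd_belowI[of _ 0]) auto
  then have low: "?r ^ n \<le> f n" if "0 < n" for n
  proof -
    have "?r \<le> root n (f n)"
      using that \<open>bdd_below _\<close> by (intro cINF_lower) auto
    then have "?r ^ n \<le> root n (f n) ^ n"
      using r assms(3) by (intro power_mono) auto
    then show ?thesis using that assms(1) by simp
  qed
  have bound: "(?r / w) ^ (2 ^ m) \<le> K / w" for m :: nat
  proof -
    \<comment> \<open>The surplus factor \<open>?r\<close> is weakened to \<open>w\<close>, so the
      shift by one only changes the constant to \<open>K / w\<close>.\<close>
    have "w * ?r ^ (2 ^ m) \<le> ?r ^ Suc (2 ^ m)"
      using r assms(3) by (simp add: mult_right_mono)
    also have "\<dots> \<le> K * w ^ (2 ^ m)"
      using low[of "Suc (2 ^ m)"] le[of m] by simp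
    finally show ?thesis using assms(3) by (simp add: field_simps)
  qed
  obtain n where n: "K / w < (?r / w) ^ n"
    using real_arch_pow[of "?r / w"] r assms(3) by auto
  have "(?r / w) ^ n \<le> (?r / w) ^ (2 ^ n)"
    using r assms(3) by (intro power_increasing less_imp_le[OF less_exp]) auto
  with bound[of n] n show False by linarith
qed

lemma Sup0_upper:
  assumes "x \<in> X" "\<And>y. y \<in> X \<Longrightarrow> y \<le> b"
  shows "x \<le> Sup0 X"
  using assms by (auto simp: Sup0_def intro!: cSup_upper bdd_aboveI)

text \<open>The separate assumption \<open>0 \<le> b\<close> covers the empty set, where
  \<open>Sup0\<close> is 0.\<close>

lemma Sup0_nonneg_le:
  assumes "\<And>y. y \<in> X \<Longrightarrow> 0 \<le> y \<and> y \<le> b" "0 \<le> b"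
  shows "0 \<le> Sup0 X" "Sup0 X \<le> b"
proof -
  show "Sup0 X \<le> b"
    using assms by (auto simp: Sup0_def intro!: cSup_least)
  show "0 \<le> Sup0 X"
    using assms Sup0_upper[of _ X b] by (cases "X = {}") (fastforce simp: Sup0_def)+
qed

locale positive_semi_inner =
  fixes A :: "'a::chilbert_space \<Rightarrow> 'a"
  assumes positive: "positive_op A"
begin

sublocale semi_inner "A_inner A"
  by (rule semi_inner_A_inner[OF positive])

lemma A_norm_sq: "(A_norm A x)\<^sup>2 = q x" and A_norm_nonneg: "0 \<le> A_norm A x"
  by (simp_all add: A_norm_def q_def diag_nonneg)

lemma A_norm_scaleR: "A_norm A (of_real s *\<^sub>C x) = \<bar>s\<bar> * A_norm A x"
  using q_scaleC[of "of_real s" x] by (simp add: A_norm_def q_def real_sqrt_mult)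

lemma normalize:
  assumes "A_norm A x \<noteq> 0"
  obtains u where "A_norm A u = 1" "x = of_real (A_norm A x) *\<^sub>C u"
proof
  let ?u = "of_real (1 / A_norm A x) *\<^sub>C x"
  show "A_norm A ?u = 1"
    using assms A_norm_nonneg[of x] by (simp only: A_norm_scaleR) simp
  show "x = of_real (A_norm A x) *\<^sub>C ?u"
    using assms by (simp only: scaleC_scaleC flip: of_real_mult) (simp add: scaleC_one)
qed

lemma A_op_norm_bound:
  assumes "0 \<le> b" and "\<And>x. A_norm A (T x) \<le> b * A_norm A x"
  shows "0 \<le> A_op_norm A T" "A_op_norm A T \<le> b"
proof -
  have "0 \<le> y \<and> y \<le> b" if y: "y \<in> {A_norm A (T x) |x. A_norm A x = 1}" for y
  proof -
    obtain x where "y = A_norm A (T x)" "A_norm A x = 1" using y by blast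
    then show ?thesis using assms(2)[of x] A_norm_nonneg by simp
  qed
  then show "0 \<le> A_op_norm A T" "A_op_norm A T \<le> b"
    unfolding A_op_norm_def by (rule Sup0_nonneg_le; use assms(1) in simp)+
qed

text \<open>Null vectors are invisible to the supremum, but the bound \<open>b\<close> forces
  \<open>T\<close> to keep them null. Every other vector is a multiple of a unit vector, and
  \<open>b\<close> makes the supremum finite.\<close>

lemma le_A_op_norm:
  assumes T: "complex_linear T" and b: "\<And>x. A_norm A (T x) \<le> b * A_norm A x"
  shows "A_norm A (T x) \<le> A_op_norm A T * A_norm A x"
proof (cases "A_norm A x = 0")
  case True
  then show ?thesis using b[of x] by simp
next
  case False
  then obtain u where u: "A_norm A u = 1" "x = of_real (A_norm A x) *\<^sub>C u"
    by (rule normalize)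
  have "y \<le> b" if y: "y \<in> {A_norm A (T x) |x. A_norm A x = 1}" for y
  proof -
    obtain x where "y = A_norm A (T x)" "A_norm A x = 1" using y by blast
    then show ?thesis using b[of x] by simp
  qed
  then have "A_norm A (T u) \<le> A_op_norm A T"
    unfolding A_op_norm_def using u(1) by (intro Sup0_upper) auto
  moreover have "A_norm A (T x) = A_norm A x * A_norm A (T u)"
    by (subst u(2)) (simp add: complex_linear_scaleC[OF T] A_norm_scaleR A_norm_nonneg)
  ultimately show ?thesis
    using A_norm_nonneg[of x] by (simp add: mult.commute[of "A_op_norm A T"] mult_left_mono)
qed

text \<open>Cauchy-Schwarz gives the crude bound \<open>b * q x\<close>, which makes the supremum
  finite and settles null vectors; the others follow from unit vectors by quadratic scaling.\<close>

lemma A_num_radius_bounds: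
  assumes T: "complex_linear T" and b: "\<And>x. A_norm A (T x) \<le> b * A_norm A x" and "0 \<le> b"
  shows "0 \<le> A_num_radius A T" "cmod (A_inner A (T x) x) \<le> A_num_radius A T * q x"
proof -
  have le: "cmod (A_inner A (T x) x) \<le> b * q x" for x
  proof (rule power2_le_imp_le)
    have "(A_norm A (T x))\<^sup>2 \<le> (b * A_norm A x)\<^sup>2"
      using b[of x] A_norm_nonneg by (intro power_mono)
    then have "q (T x) * q x \<le> (b\<^sup>2 * q x) * q x"
      by (intro mult_right_mono) (simp_all add: power_mult_distrib A_norm_sq q_nonneg)
    with cauchy_schwarz[of "T x" x] show "(cmod (A_inner A (T x) x))\<^sup>2 \<le> (b * q x)\<^sup>2"
      by (simp add: power2_eq_square mult_ac)
  qed (use assms q_nonneg in simp)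
  have ub: "y \<le> b" if y: "y \<in> {cmod (A_inner A (T x) x) |x. A_norm A x = 1}" for y
  proof -
    obtain x where "y = cmod (A_inner A (T x) x)" "A_norm A x = 1" using y by blast
    then show ?thesis using le[of x] by (simp flip: A_norm_sq)
  qed
  show "0 \<le> A_num_radius A T"
    unfolding A_num_radius_def by (rule Sup0_nonneg_le[where b = b]) (use ub assms in auto)
  show "cmod (A_inner A (T x) x) \<le> A_num_radius A T * q x"
  proof (cases "A_norm A x = 0")
    case True
    then show ?thesis using le[of x] by (simp flip: A_norm_sq)
  next
    case False
    then obtain u where u: "A_norm A u = 1" "x = of_real (A_norm A x) *\<^sub>C u"
      by (rule normalize)
    have "cmod (A_inner A (T u) u) \<le> A_num_radius A T"
      unfolding A_num_radius_def using u(1) ub by (intro Sup0_upper[where b = b]) auto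
    moreover have "cmod (A_inner A (T x) x) = q x * cmod (A_inner A (T u) u)"
      by (subst u(2), subst (2) u(2))
        (simp add: complex_linear_scaleC[OF T] B_simps norm_mult A_norm_nonneg
          flip: A_norm_sq power2_eq_square)
    ultimately show ?thesis
      using q_nonneg[of x] by (simp add: mult.commute[of "A_num_radius A T"] mult_left_mono)
  qed
qed

section \<open>Composites of \<open>A\<close>-bounded operators and the spectral radius of a sum of
  products\<close>

lemma A_bounded_obtain:
  assumes "A_bounded A T"
  obtains b where "0 \<le> b" "\<And>x. A_norm A (T x) \<le> b * A_norm A x"
  using assms by (meson A_bounded_def less_imp_le)

lemma A_bounded_compose:
  assumes "A_bounded A T" "A_bounded A S"
  obtains b where "0 \<le> b" "\<And>x. A_norm A (T (S x)) \<le> b * A_norm A x"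
proof -
  obtain k l where "0 \<le> k" "\<And>x. A_norm A (T x) \<le> k * A_norm A x"
    "0 \<le> l" "\<And>x. A_norm A (S x) \<le> l * A_norm A x"
    using assms by (meson A_bounded_obtain)
  then have "A_norm A (T (S x)) \<le> k * l * A_norm A x" for x
    by (metis mult.assoc mult_left_mono order_trans)
  with \<open>0 \<le> k\<close> \<open>0 \<le> l\<close> that[of "k * l"] show thesis by simp
qed

lemma q_le_of_A_norm_le:
  assumes "A_norm A y \<le> b * A_norm A x"
  shows "q y \<le> b\<^sup>2 * q x"
  using power_mono[OF assms A_norm_nonneg, of 2] by (simp add: power_mult_distrib A_norm_sq)

text \<open>The bound is the largest eigenvalue of the real matrix with rows \<open>(a, b)\<close>
  and \<open>(c, d)\<close>.\<close>

lemma A_spec_radius_sum_le: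
  assumes lin: "complex_linear T1" "complex_linear T2" "complex_linear S1" "complex_linear S2"
    and bd: "\<exists>k. \<forall>x. q (T1 x) \<le> k * q x" "\<exists>k. \<forall>x. q (T2 x) \<le> k * q x"
      "\<exists>k. \<forall>x. q (S1 x) \<le> k * q x" "\<exists>k. \<forall>x. q (S2 x) \<le> k * q x"
    and nonneg: "0 \<le> a" "0 \<le> b" "0 \<le> c" "0 \<le> d"
    and a_le: "\<And>x. cmod (A_inner A (S1 (T1 x)) x) \<le> a * q x"
    and d_le: "\<And>x. cmod (A_inner A (S2 (T2 x)) x) \<le> d * q x"
    and b_le: "\<And>x. q (S1 (T2 x)) \<le> b\<^sup>2 * q x"
    and c_le: "\<And>x. q (S2 (T1 x)) \<le> c\<^sup>2 * q x"
  shows "A_spec_radius A (\<lambda>x. T1 (S1 x) + T2 (S2 x))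
    \<le> 1/2 * (a + d + sqrt ((a - d)\<^sup>2 + 4 * b * c))" (is "?r \<le> ?w")
\<comment> \<open>Any \<open>w\<close> strictly above the eigenvalue satisfies the strict
  determinant condition needed for a balancing weight.\<close>
proof (rule dense_ge)
  fix w assume w: "?w < w"
  define P where "P = (\<lambda>x. T1 (S1 x) + T2 (S2 x))"
  obtain k1 k2 k3 k4 where k: "\<And>x. q (T1 x) \<le> k1 * q x" "\<And>x. q (T2 x) \<le> k2 * q x"
    "\<And>x. q (S1 x) \<le> k3 * q x" "\<And>x. q (S2 x) \<le> k4 * q x"
    using bd by metis
  define k where "k = \<bar>k1\<bar> + \<bar>k2\<bar> + \<bar>k3\<bar> + \<bar>k4\<bar>"
  have mono: "q y \<le> k * q x" if "q y \<le> l * q x" "l \<le> k" for l x y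
    by (rule order_trans[OF that(1) mult_right_mono[OF that(2) q_nonneg]])
  have kk: "k1 \<le> k" "k2 \<le> k" "k3 \<le> k" "k4 \<le> k" "0 \<le> k" by (auto simp: k_def)
  have bd': "\<And>x. q (T1 x) \<le> k * q x" "\<And>x. q (T2 x) \<le> k * q x"
    "\<And>x. q (S1 x) \<le> k * q x" "\<And>x. q (S2 x) \<le> k * q x"
    using mono k kk by blast+
  let ?s = "sqrt ((a - d)\<^sup>2 + 4 * b * c)"
  have "0 \<le> 4 * b * c" using nonneg by simp
  then have s: "\<bar>a - d\<bar> \<le> ?s" "?s\<^sup>2 = (a - d)\<^sup>2 + 4 * b * c"
    by (auto intro!: real_le_rsqrt real_sqrt_pow2 add_nonneg_nonneg)
  have w': "?s < 2 * w - a - d" using w by simp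
  have wa: "a < w" "d < w" "0 < w" using s(1) w' nonneg by linarith+
  \<comment> \<open>The determinant condition results from
    \<open>(2 w - a - d)^2 - (a - d)^2 = 4 (w - a) (w - d)\<close>.\<close>
  have "?s\<^sup>2 < (2 * w - a - d)\<^sup>2"
    using w' s(1) by (intro power_strict_mono) linarith+
  then have det: "b * c < (w - a) * (w - d)"
    unfolding s(2) by (simp add: power2_eq_square algebra_simps)
  obtain C where C: "0 \<le> C"
    "\<And>m x. q ((P ^^ Suc (2 ^ m)) x) \<le> C * (w ^ (2 ^ m))\<^sup>2 * q x"
    using powers_sum_le[OF lin bd' kk(5) nonneg(2,3) wa(3,1,2) det a_le d_le b_le c_le]
    unfolding P_def by blast
  have qP: "q (P x) \<le> (4 * k * k) * q x" for x
  proof -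
    have "q (P x) \<le> 2 * q (T1 (S1 x)) + 2 * q (T2 (S2 x))"
      using q_parallelogram[of "T1 (S1 x)" "T2 (S2 x)"] q_nonneg[of "T1 (S1 x) - T2 (S2 x)"]
      by (simp add: P_def)
    also have "\<dots> \<le> 2 * (k * q (S1 x)) + 2 * (k * q (S2 x))"
      by (intro add_mono mult_left_mono bd') simp_all
    also have "\<dots> \<le> 2 * (k * (k * q x)) + 2 * (k * (k * q x))"
      using kk(5) by (intro add_mono mult_left_mono bd') simp_all
    finally show ?thesis by simp
  qed
  have norm_le: "A_norm A y \<le> sqrt l * A_norm A x" if "q y \<le> l * q x" for x y l
    using real_sqrt_le_mono[OF that] by (simp add: A_norm_def q_def real_sqrt_mult)
  \<comment> \<open>This crude growth bound ensures that the norm of every power is a supremum of a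
    bounded set, hence nonnegative.\<close>
  have qPn: "q ((P ^^ n) x) \<le> (4 * k * k) ^ n * q x" for n x
  proof (induction n)
    case (Suc n)
    have "q ((P ^^ Suc n) x) \<le> (4 * k * k) * q ((P ^^ n) x)"
      using qP by simp
    also have "\<dots> \<le> (4 * k * k) * ((4 * k * k) ^ n * q x)"
      using kk(5) by (intro mult_left_mono Suc) simp_all
    finally show ?case by (simp add: mult_ac)
  qed simp
  have "A_op_norm A (P ^^ Suc (2 ^ m)) \<le> sqrt C * w ^ (2 ^ m)" for m
    using norm_le[OF C(2)] C(1) wa(3)
    by (intro A_op_norm_bound) (simp_all add: real_sqrt_mult)
  moreover have "0 \<le> A_op_norm A (P ^^ n)" for n
    using norm_le[OF qPn, of n] kk(5)
    by (intro A_op_norm_bound[of "sqrt ((4 * k * k) ^ n)"]) simp_all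
  ultimately show "?r \<le> w"
    unfolding A_spec_radius_def P_def[symmetric]
    using C(1) wa(3) by (intro INF_root_le_of_dyadic_growth[where K = "sqrt C"]) simp_all
qed

end

section \<open>Sums, differences and commuting products of two operators\<close>

theorem corollary2p5:
  fixes A T S :: "'a::chilbert_space \<Rightarrow> 'a"
  assumes "positive_op A" and "A_bounded A T" and "A_bounded A S"
  shows "A_spec_radius A (\<lambda>x. T (S x) + S (T x))
      \<le> 1/2 * (A_num_radius A (T \<circ> S) + A_num_radius A (S \<circ> T)
          + sqrt ((A_num_radius A (T \<circ> S) - A_num_radius A (S \<circ> T))\<^sup>2
              + 4 * A_op_norm A (T ^^ 2) * A_op_norm A (S ^^ 2)))
    \<and> A_spec_radius A (\<lambda>x. T (S x) - S (T x))
      \<le> 1/2 * (A_num_radius A (T \<circ> S) + A_num_radius A (S \<circ> T)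
          + sqrt ((A_num_radius A (T \<circ> S) - A_num_radius A (S \<circ> T))\<^sup>2
              + 4 * A_op_norm A (T ^^ 2) * A_op_norm A (S ^^ 2)))
    \<and> (T \<circ> S = S \<circ> T \<longrightarrow>
        A_spec_radius A (T \<circ> S)
        \<le> 1/2 * (A_num_radius A (T \<circ> S)
            + sqrt (A_op_norm A (T ^^ 2)) * sqrt (A_op_norm A (S ^^ 2))))"
proof -
  interpret positive_semi_inner A by standard (rule assms)
  let ?ts = "A_num_radius A (T \<circ> S)" and ?st = "A_num_radius A (S \<circ> T)"
  let ?t = "A_op_norm A (T ^^ 2)" and ?s = "A_op_norm A (S ^^ 2)"
  have lin: "complex_linear T" "complex_linear S"
    using assms A_bounded_complex_linear by auto
  have sqr: "T ^^ 2 = (\<lambda>x. T (T x))" "S ^^ 2 = (\<lambda>x. S (S x))"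
    by (auto simp: numeral_2_eq_2)
  have bd: "\<exists>k. \<forall>x. q (T x) \<le> k * q x" "\<exists>k. \<forall>x. q (S x) \<le> k * q x"
    using assms(2,3) by (meson A_bounded_obtain q_le_of_A_norm_le)+
  have ts: "0 \<le> ?ts" "cmod (A_inner A (T (S x)) x) \<le> ?ts * q x" for x
  proof -
    obtain b where "0 \<le> b" "\<And>x. A_norm A (T (S x)) \<le> b * A_norm A x"
      by (rule A_bounded_compose[OF assms(2) assms(3)], rule that)
    then show "0 \<le> ?ts" "cmod (A_inner A (T (S x)) x) \<le> ?ts * q x"
      using A_num_radius_bounds[OF complex_linear_compose[OF lin(1,2)], of b]
      by (simp_all add: comp_def)
  qed
  have st: "0 \<le> ?st" "cmod (A_inner A (S (T x)) x) \<le> ?st * q x" for x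
  proof -
    obtain b where "0 \<le> b" "\<And>x. A_norm A (S (T x)) \<le> b * A_norm A x"
      by (rule A_bounded_compose[OF assms(3) assms(2)], rule that)
    then show "0 \<le> ?st" "cmod (A_inner A (S (T x)) x) \<le> ?st * q x"
      using A_num_radius_bounds[OF complex_linear_compose[OF lin(2,1)], of b]
      by (simp_all add: comp_def)
  qed
  have tt: "0 \<le> ?t" "q (T (T x)) \<le> ?t\<^sup>2 * q x" for x
  proof -
    obtain b where b: "0 \<le> b" "\<And>x. A_norm A (T (T x)) \<le> b * A_norm A x"
      by (rule A_bounded_compose[OF assms(2) assms(2)], rule that)
    then show "0 \<le> ?t" unfolding sqr by (rule A_op_norm_bound)
    show "q (T (T x)) \<le> ?t\<^sup>2 * q x"
      unfolding sqr
      by (rule q_le_of_A_norm_le[OF le_A_op_norm[OF complex_linear_compose[OF lin(1,1)] b(2)]])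
  qed
  have ss: "0 \<le> ?s" "q (S (S x)) \<le> ?s\<^sup>2 * q x" for x
  proof -
    obtain b where b: "0 \<le> b" "\<And>x. A_norm A (S (S x)) \<le> b * A_norm A x"
      by (rule A_bounded_compose[OF assms(3) assms(3)], rule that)
    then show "0 \<le> ?s" unfolding sqr by (rule A_op_norm_bound)
    show "q (S (S x)) \<le> ?s\<^sup>2 * q x"
      unfolding sqr
      by (rule q_le_of_A_norm_le[OF le_A_op_norm[OF complex_linear_compose[OF lin(2,2)] b(2)]])
  qed
  have q_minus: "q (- x) = q x" for x
    by (simp add: q_def minus_left minus_right)
  \<comment> \<open>The operator matrix has diagonal \<open>S T\<close>, \<open>T S\<close> and
    off-diagonal entries \<open>S^2\<close>, \<open>T^2\<close>; the resulting bound is symmetric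
    under exchanging the two diagonal and the two off-diagonal values.\<close>
  have plus: "A_spec_radius A (\<lambda>x. T (S x) + S (T x))
      \<le> 1/2 * (?ts + ?st + sqrt ((?ts - ?st)\<^sup>2 + 4 * ?t * ?s))"
    using A_spec_radius_sum_le[OF lin lin(2,1) bd bd(2,1) st(1) ss(1) tt(1) ts(1)
        st(2) ts(2) ss(2) tt(2)]
    by (simp add: add.commute mult_ac power2_commute)
  have lin': "complex_linear (\<lambda>x. - T x)"
    using complex_linear_scaleC_compose[OF lin(1), of "-1"] by (simp only: scaleC_minus1)
  \<comment> \<open>The sign is put into the second inner factor \<open>- T\<close>, which leaves
    all four estimates of the matrix entries unchanged.\<close>
  have minus: "A_spec_radius A (\<lambda>x. T (S x) + S (- T x))
      \<le> 1/2 * (?st + ?ts + sqrt ((?st - ?ts)\<^sup>2 + 4 * ?s * ?t))"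
    by (rule A_spec_radius_sum_le[OF lin lin(2) lin'])
      (use bd st ss tt ts in \<open>simp_all add: q_minus minus_left\<close>)
  let ?h = "\<lambda>f x. of_real (1/2) *\<^sub>C f x :: 'a"
  have half: "A_spec_radius A (T \<circ> S) \<le> 1/2 * (?ts + sqrt ?t * sqrt ?s)" if "T \<circ> S = S \<circ> T"
  proof -
    have eq: "S (T x) = T (S x)" for x using that by (metis comp_apply)
    have qh: "q (?h f x) = q (f x) / 4" for f x
      by (simp only: q_scaleC) (simp add: power2_eq_square)
    \<comment> \<open>Writing \<open>T S\<close> as \<open>(T/2) S + (S/2) T\<close> halves all four
      entries. Both diagonal bounds are \<open>?ts / 2\<close>, so the square root collapses to
      \<open>sqrt (?s * ?t)\<close>.\<close>
    have "A_spec_radius A (\<lambda>x. ?h T (S x) + ?h S (T x))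
        \<le> 1/2 * (?ts / 2 + ?ts / 2 + sqrt ((?ts / 2 - ?ts / 2)\<^sup>2 + 4 * (?s / 2) * (?t / 2)))"
    proof (rule A_spec_radius_sum_le[where ?T1.0 = "?h T" and ?T2.0 = "?h S"
          and ?S1.0 = S and ?S2.0 = T])
      have "\<exists>k. \<forall>x. q (?h f x) \<le> k * q x" if "\<exists>k. \<forall>x. q (f x) \<le> k * q x" for f
      proof -
        obtain k where k: "\<And>x. q (f x) \<le> k * q x"
          using \<open>\<exists>k. \<forall>x. q (f x) \<le> k * q x\<close> by blast
        have "q (?h f x) \<le> (k / 4) * q x" for x unfolding qh using k[of x] by simp
        then show ?thesis by blast
      qed
      then show "\<exists>k. \<forall>x. q (?h T x) \<le> k * q x" "\<exists>k. \<forall>x. q (?h S x) \<le> k * q x"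
        using bd by blast+
      show "cmod (A_inner A (S (?h T x)) x) \<le> ?ts / 2 * q x"
        "cmod (A_inner A (T (?h S x)) x) \<le> ?ts / 2 * q x" for x
        unfolding lin[THEN complex_linear_scaleC] scaleC_left norm_mult eq
        using ts(2)[of x] by simp_all
      show "q (S (?h S x)) \<le> (?s / 2)\<^sup>2 * q x" "q (T (?h T x)) \<le> (?t / 2)\<^sup>2 * q x" for x
        unfolding lin[THEN complex_linear_scaleC] q_scaleC using ss(2)[of x] tt(2)[of x]
        by (simp_all add: power_divide)
    qed (use lin complex_linear_scaleC_compose bd ts ss tt in simp_all)
    moreover have "(\<lambda>x. ?h T (S x) + ?h S (T x)) = T \<circ> S"
      by (simp add: fun_eq_iff eq scaleC_one flip: scaleC_add_left)
    ultimately show ?thesis by (simp add: real_sqrt_mult mult.commute)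
  qed
  show ?thesis
    using plus minus half
    by (simp add: complex_linear_minus[OF lin(2)] add.commute mult_ac power2_commute)
qed

end
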